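(* Let $G=(V,E)$ be a threshold graph with minimum degree $\delta(G)\ge 1$ that is not isomorphic to a star. Let $(K,S)$ be a canonical split partition of $G$ (if $G$ is complete, $K=V$ and $S=\emptyset$), and let $S_1=\{s\in S:\deg_G(s)=1\}$. Then \[ noc(G)=(|S|+1)+|K|+N_U+2^{|S_1|},\qquad\text{where } N_U=\begin{cases}0 & \text{if } \delta(G)\ge 2,\\ 2^{|S_1|}-1 & \text{if } \delta(G)=1.\end{cases} \] Moreover, $noc(G)$ can be computed in $O(|V|+|E|)$ time.
   Context: For a finite simple undirected graph $G=(V,E)$, a set $S\subseteq V$ is called $P_3$-convex if for every path $x$--$z$--$y$ in $G$ (distinct vertices $x,z,y$ with $xz,zy\in E$) with $x,y\in S$, we also have $z\in S$. The number $noc(G)$ denotes the number of $P_3$-convex subsets of $V$ (including $\emptyset$). A threshold graph is a graph with no induced $P_4$, $C_4$ or $2K_2$; equivalently, a graph obtained from a single vertex by repeatedly adding an isolated vertex or a universal vertex. A split partition $(K,S)$ of $G$ is a partition of $V$ into a clique $K$ and an independent set $S$; it is canonical if $|K|=\omega(G)$, the size of a maximum clique of $G$. A star is a graph $K_{1,m}$. *)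

theory Defs imports Main
begin

record 'a graph =
  verts :: "'a set"
  edges :: "'a set set"

text \<open>Finite simple undirected graphs; the vertex set is nonempty by convention.\<close>

definition simple_graph :: "'a graph \<Rightarrow> bool" where
  "simple_graph G \<longleftrightarrow> finite (verts G) \<and> verts G \<noteq> {} \<and>
     (\<forall>e\<in>edges G. \<exists>x\<in>verts G. \<exists>y\<in>verts G. x \<noteq> y \<and> e = {x, y})"

definition degree :: "'a graph \<Rightarrow> 'a \<Rightarrow> nat" where
  "degree G v = card {u. {v, u} \<in> edges G}"

definition min_degree :: "'a graph \<Rightarrow> nat" where
  "min_degree G = Min (degree G ` verts G)"

definition graph_iso :: "'a graph \<Rightarrow> 'b graph \<Rightarrow> bool" where
  "graph_iso G H \<longleftrightarrow> (\<exists>f. bij_betw f (verts G) (verts H) \<and>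
     (\<forall>x\<in>verts G. \<forall>y\<in>verts G. {x, y} \<in> edges G \<longleftrightarrow> {f x, f y} \<in> edges H))"

definition induced_subgraph :: "'a graph \<Rightarrow> 'a set \<Rightarrow> 'a graph" where
  "induced_subgraph G W = \<lparr>verts = W, edges = {e \<in> edges G. e \<subseteq> W}\<rparr>"

definition has_induced :: "'a graph \<Rightarrow> 'b graph \<Rightarrow> bool" where
  "has_induced G H \<longleftrightarrow> (\<exists>W\<subseteq>verts G. graph_iso (induced_subgraph G W) H)"

definition P4 :: "nat graph" where
  "P4 = \<lparr>verts = {0, 1, 2, 3}, edges = {{0, 1}, {1, 2}, {2, 3}}\<rparr>"

definition C4 :: "nat graph" where
  "C4 = \<lparr>verts = {0, 1, 2, 3}, edges = {{0, 1}, {1, 2}, {2, 3}, {3, 0}}\<rparr>"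

definition two_K2 :: "nat graph" where
  "two_K2 = \<lparr>verts = {0, 1, 2, 3}, edges = {{0, 1}, {2, 3}}\<rparr>"

definition threshold_graph :: "'a graph \<Rightarrow> bool" where
  "threshold_graph G \<longleftrightarrow> simple_graph G \<and>
     \<not> has_induced G P4 \<and> \<not> has_induced G C4 \<and> \<not> has_induced G two_K2"

definition star :: "nat \<Rightarrow> nat graph" where
  "star m = \<lparr>verts = {0..m}, edges = {{0, i} | i. i \<in> {1..m}}\<rparr>"

definition is_star :: "'a graph \<Rightarrow> bool" where
  "is_star G \<longleftrightarrow> (\<exists>m. graph_iso G (star m))"

definition clique :: "'a graph \<Rightarrow> 'a set \<Rightarrow> bool" where
  "clique G K \<longleftrightarrow> K \<subseteq> verts G \<and> (\<forall>x\<in>K. \<forall>y\<in>K. x \<noteq> y \<longrightarrow> {x, y} \<in> edges G)"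

definition independent :: "'a graph \<Rightarrow> 'a set \<Rightarrow> bool" where
  "independent G S \<longleftrightarrow> S \<subseteq> verts G \<and> (\<forall>x\<in>S. \<forall>y\<in>S. {x, y} \<notin> edges G)"

definition clique_number :: "'a graph \<Rightarrow> nat" where
  "clique_number G = Max (card ` {K. clique G K})"

definition split_partition :: "'a graph \<Rightarrow> 'a set \<Rightarrow> 'a set \<Rightarrow> bool" where
  "split_partition G K S \<longleftrightarrow>
     K \<union> S = verts G \<and> K \<inter> S = {} \<and> clique G K \<and> independent G S"

text \<open>For complete \<open>G\<close> this forces \<open>K = verts G\<close> and \<open>S = {}\<close>.\<close>

definition canonical_split_partition :: "'a graph \<Rightarrow> 'a set \<Rightarrow> 'a set \<Rightarrow> bool" where
  "canonical_split_partition G K S \<longleftrightarrow> split_partition G K S \<and> card K = clique_number G"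

definition P3_convex :: "'a graph \<Rightarrow> 'a set \<Rightarrow> bool" where
  "P3_convex G S \<longleftrightarrow> S \<subseteq> verts G \<and>
     (\<forall>x z y. distinct [x, z, y] \<and> {x, z} \<in> edges G \<and> {z, y} \<in> edges G \<and> x \<in> S \<and> y \<in> S
        \<longrightarrow> z \<in> S)"

definition noc :: "'a graph \<Rightarrow> nat" where
  "noc G = card {S. P3_convex G S}"

text \<open>
  A random access machine with registers and a memory of natural numbers.  Each instruction
  takes one unit of time.  Subtraction is truncated and division by zero gives zero.
  A configuration is halted when the program counter has left the program.
\<close>

datatype arith = Plus | Minus | Times | Divide

fun arith_op :: "arith \<Rightarrow> nat \<Rightarrow> nat \<Rightarrow> nat" where
  "arith_op Plus a b = a + b"
| "arith_op Minus a b = a - b"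
| "arith_op Times a b = a * b"
| "arith_op Divide a b = a div b"

datatype instr =
    Const nat nat
  | Arith arith nat nat nat
  | Load nat nat
  | Store nat nat
  | Jump_zero nat nat

record config =
  pc :: nat
  regs :: "nat \<Rightarrow> nat"
  mem :: "nat \<Rightarrow> nat"

fun exec :: "instr \<Rightarrow> config \<Rightarrow> config" where
  "exec (Const r k) s = s\<lparr>pc := pc s + 1, regs := (regs s)(r := k)\<rparr>"
| "exec (Arith f r a b) s =
     s\<lparr>pc := pc s + 1, regs := (regs s)(r := arith_op f (regs s a) (regs s b))\<rparr>"
| "exec (Load r a) s = s\<lparr>pc := pc s + 1, regs := (regs s)(r := mem s (regs s a))\<rparr>"
| "exec (Store a r) s = s\<lparr>pc := pc s + 1, mem := (mem s)(regs s a := regs s r)\<rparr>"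
| "exec (Jump_zero r l) s = s\<lparr>pc := (if regs s r = 0 then l else pc s + 1)\<rparr>"

definition halted :: "instr list \<Rightarrow> config \<Rightarrow> bool" where
  "halted P s \<longleftrightarrow> length P \<le> pc s"

definition step :: "instr list \<Rightarrow> config \<Rightarrow> config" where
  "step P s = (if halted P s then s else exec (P ! pc s) s)"

definition init_config :: "nat list \<Rightarrow> config" where
  "init_config xs =
     \<lparr>pc = 0, regs = (\<lambda>_. 0), mem = (\<lambda>i. if i < length xs then xs ! i else 0)\<rparr>"

text \<open>
  A number is output in binary, least significant digit first and possibly with leading zeros:
  register 0 holds the number of digits and register 1 the address of the first one.
  Numbers such as \<open>2 ^ card S\<close> do not fit into a machine word, so they are not
  allowed as the content of a single register.
\<close>

definition outputs :: "config \<Rightarrow> nat \<Rightarrow> bool" where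
  "outputs s x \<longleftrightarrow> (\<forall>i<regs s 0. mem s (regs s 1 + i) \<le> 1) \<and>
     x = (\<Sum>i<regs s 0. mem s (regs s 1 + i) * 2 ^ i)"

text \<open>
  \<open>T\<close> bounds the time; \<open>W\<close> bounds the content of every register and memory cell at all times,
  which expresses the word size.
\<close>

definition ram_computes ::
  "instr list \<Rightarrow> nat list \<Rightarrow> nat \<Rightarrow> nat \<Rightarrow> nat \<Rightarrow> bool" where
  "ram_computes P xs x T W \<longleftrightarrow> (\<exists>t\<le>T.
     (\<forall>k\<le>t. \<forall>i. regs ((step P ^^ k) (init_config xs)) i \<le> W \<and>
                  mem ((step P ^^ k) (init_config xs)) i \<le> W) \<and>
     halted P ((step P ^^ t) (init_config xs)) \<and>
     outputs ((step P ^^ t) (init_config xs)) x)"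

text \<open>
  The input is a graph on \<open>{..<n}\<close> given by its adjacency lists in arbitrary order.
  In memory: the number \<open>n\<close>, then \<open>n + 1\<close> addresses, then the concatenated lists; the list of
  vertex \<open>i\<close> extends from the \<open>i\<close>-th address (inclusive) to the next one (exclusive).
\<close>

definition adjacency_lists :: "nat graph \<Rightarrow> nat list list \<Rightarrow> bool" where
  "adjacency_lists G adj \<longleftrightarrow> verts G = {..<length adj} \<and>
     (\<forall>v<length adj. distinct (adj ! v) \<and> set (adj ! v) = {u. {v, u} \<in> edges G})"

definition encode :: "nat list list \<Rightarrow> nat list" where
  "encode adj = length adj #
     map (\<lambda>i. length adj + 2 + (\<Sum>j<i. length (adj ! j))) [0..<length adj + 1] @ concat adj"

text \<open>
  Time \<open>O(|V| + |E|)\<close> with words of \<open>log (|V| + |E|) + O(1)\<close> bits.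
\<close>

definition linear_time_computable :: "(nat graph \<Rightarrow> bool) \<Rightarrow> (nat graph \<Rightarrow> nat) \<Rightarrow> bool" where
  "linear_time_computable C f \<longleftrightarrow> (\<exists>P c. \<forall>G adj. C G \<and> adjacency_lists G adj \<longrightarrow>
     ram_computes P (encode adj) (f G)
       (c * (card (verts G) + card (edges G))) (c * (card (verts G) + card (edges G))))"

end

theory Submission imports Defs
begin

text \<open>
  A threshold graph without isolated vertices has a universal vertex \<open>u\<close>.  Let \<open>D\<close> be the set of
  vertices of degree 1 and \<open>Q\<close> the set of the remaining vertices other than \<open>u\<close>; unless the graph is a
  star, \<open>Q\<close> is nonempty.  A convex set with at least two elements contains \<open>u\<close>.  If it moreover meets
  \<open>Q\<close> then it contains all of \<open>Q\<close>, since it is closed under neighbours in \<open>Q\<close> and two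
  disjoint edges in \<open>Q\<close> are joined by a third one, by the absence of an induced \<open>2 K\<^sub>2\<close>.  So the convex sets are the empty set,
  the singletons other than \<open>{u}\<close>, and the sets \<open>{u} \<union> A\<close> and \<open>{u} \<union> Q \<union> A\<close> with \<open>A \<subseteq> D\<close>.  This makes
  \<open>|V| + 2 ^ (|D| + 1)\<close> sets, a form of the claimed number that covers both values of \<open>N_U\<close> and whose
  binary digits can be computed from the degrees alone.
\<close>

section \<open>Universal vertices of threshold graphs\<close>

lemma edge_vertsD:
  assumes "simple_graph G" "{x, y} \<in> edges G"
  shows "x \<in> verts G" "y \<in> verts G" "x \<noteq> y"
proof -
  obtain a b where "a \<in> verts G" "b \<in> verts G" "a \<noteq> b" "{x, y} = {a, b}"
    using assms unfolding simple_graph_def by blast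
  then show "x \<in> verts G" "y \<in> verts G" "x \<noteq> y"
    by (auto simp: doubleton_eq_iff)
qed

lemma finite_neighbours:
  assumes "simple_graph G"
  shows "finite {u. {v, u} \<in> edges G}"
proof (rule finite_subset)
  show "{u. {v, u} \<in> edges G} \<subseteq> verts G"
    using edge_vertsD[OF assms] by blast
  show "finite (verts G)" using assms by (simp add: simple_graph_def)
qed

lemma min_degree_ge_iff:
  assumes "simple_graph G"
  shows "k \<le> min_degree G \<longleftrightarrow> (\<forall>v\<in>verts G. k \<le> degree G v)"
  using assms unfolding min_degree_def simple_graph_def by simp

text \<open>Serves to exhibit the forbidden subgraphs. The six equivalences settle all pairs of
  distinct vertices; \<open>graph_iso\<close> also compares pairs with \<open>x = y\<close>, hence
  the condition that \<open>H\<close> has no edge \<open>{i}\<close>.\<close>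

lemma has_induced_four:
  assumes "simple_graph G" and dist: "distinct [a, b, c, d]"
    and "{a, b, c, d} \<subseteq> verts G"
    and H: "verts H = {0, 1, 2, 3 :: nat}" "\<And>i. {i} \<notin> edges H"
    and "{a, b} \<in> edges G \<longleftrightarrow> {0, 1} \<in> edges H"
    and "{a, c} \<in> edges G \<longleftrightarrow> {0, 2} \<in> edges H"
    and "{a, d} \<in> edges G \<longleftrightarrow> {0, 3} \<in> edges H"
    and "{b, c} \<in> edges G \<longleftrightarrow> {1, 2} \<in> edges H"
    and "{b, d} \<in> edges G \<longleftrightarrow> {1, 3} \<in> edges H"
    and "{c, d} \<in> edges G \<longleftrightarrow> {2, 3} \<in> edges H"
  shows "has_induced G H"
proof -
  define f where "f v = (if v = a then 0 else if v = b then 1 else if v = c then 2 else 3 :: nat)"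
    for v
  have f: "f a = 0" "f b = 1" "f c = 2" "f d = 3"
    using dist by (auto simp: f_def)
  have "bij_betw f {a, b, c, d} (verts H)"
    unfolding bij_betw_def inj_on_def using f H(1) by auto
  moreover have "\<And>x. {x} \<notin> edges G"
    using edge_vertsD(3)[OF assms(1), of x x for x] by auto
  ultimately have "graph_iso (induced_subgraph G {a, b, c, d}) H"
    unfolding graph_iso_def induced_subgraph_def
    using assms(6-) f H(2)
    by (intro exI[of _ f]) (auto simp: insert_commute)
  then show ?thesis
    unfolding has_induced_def using assms(3) by blast
qed

lemma threshold_graph_not_two_K2:
  assumes "threshold_graph G" "distinct [a, b, c, d]"
    "{a, b} \<in> edges G" "{c, d} \<in> edges G"
    "{a, c} \<notin> edges G" "{a, d} \<notin> edges G" "{b, c} \<notin> edges G" "{b, d} \<notin> edges G"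
  shows False
proof -
  have sg: "simple_graph G" using assms(1) by (simp add: threshold_graph_def)
  have "has_induced G two_K2"
    by (rule has_induced_four[OF sg assms(2)])
      (use assms edge_vertsD[OF sg] in \<open>auto simp: two_K2_def doubleton_eq_iff singleton_insert_inj_eq\<close>)
  then show False using assms(1) by (simp add: threshold_graph_def)
qed

text \<open>Only the pairs \<open>x\<close>, \<open>y\<close> and \<open>a\<close>, \<open>b\<close>
  are undecided. Neither being an edge gives an induced \<open>two_K2\<close>, exactly one gives a
  \<open>P4\<close>, and both give a \<open>C4\<close>.\<close>

lemma threshold_graph_alternating:
  assumes "threshold_graph G" "distinct [x, a, y, b]"
    "{x, a} \<in> edges G" "{y, b} \<in> edges G" "{x, b} \<notin> edges G" "{y, a} \<notin> edges G"
  shows False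
proof -
  have sg: "simple_graph G" using assms(1) by (simp add: threshold_graph_def)
  have V: "{x, a, y, b} \<subseteq> verts G" using assms edge_vertsD[OF sg] by blast
  have d: "distinct [x, a, y, b]" "distinct [a, x, y, b]" "distinct [x, a, b, y]"
    using assms(2) by auto
  consider "{x, y} \<notin> edges G" "{a, b} \<notin> edges G" | "{x, y} \<in> edges G" "{a, b} \<notin> edges G"
    | "{x, y} \<notin> edges G" "{a, b} \<in> edges G" | "{x, y} \<in> edges G" "{a, b} \<in> edges G"
    by blast
  then show False
  proof cases
    case 1
    then show False using threshold_graph_not_two_K2[OF assms(1,2,3,4)] assms(5,6)
      by (simp add: insert_commute)
  next
    case 2
    then have "has_induced G P4"
      by (intro has_induced_four[OF sg d(2)])
        (use assms V in \<open>auto simp: P4_def doubleton_eq_iff singleton_insert_inj_eq insert_commute\<close>)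
    then show False using assms(1) by (simp add: threshold_graph_def)
  next
    case 3
    then have "has_induced G P4"
      by (intro has_induced_four[OF sg d(3)])
        (use assms V in \<open>auto simp: P4_def doubleton_eq_iff singleton_insert_inj_eq insert_commute\<close>)
    then show False using assms(1) by (simp add: threshold_graph_def)
  next
    case 4
    then have "has_induced G C4"
      by (intro has_induced_four[OF sg d(3)])
        (use assms V in \<open>auto simp: C4_def doubleton_eq_iff singleton_insert_inj_eq insert_commute\<close>)
    then show False using assms(1) by (simp add: threshold_graph_def)
  qed
qed

text \<open>A vertex \<open>u\<close> of maximum degree works: if \<open>v\<close> were not adjacent
  to it, any neighbour \<open>w\<close> of \<open>v\<close> would have larger degree than
  \<open>u\<close>.\<close>

lemma threshold_graph_universal_vertex:
  assumes th: "threshold_graph G" and "min_degree G \<ge> 1"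
  obtains u where "u \<in> verts G" "\<And>v. v \<in> verts G \<Longrightarrow> v \<noteq> u \<Longrightarrow> {u, v} \<in> edges G"
proof -
  let ?N = "\<lambda>v. {w. {v, w} \<in> edges G}"
  have sg: "simple_graph G" using th by (simp add: threshold_graph_def)
  then have fin: "finite (verts G)" "verts G \<noteq> {}" by (auto simp: simple_graph_def)
  obtain u where u: "u \<in> verts G" "\<And>v. v \<in> verts G \<Longrightarrow> degree G v \<le> degree G u"
    using fin obtains_MAX[of "verts G" "degree G"]
    by (metis Max_ge finite_imageI imageI)
  have "{u, v} \<in> edges G" if v: "v \<in> verts G" "v \<noteq> u" for v
  proof (rule ccontr)
    assume uv: "{u, v} \<notin> edges G"
    have "degree G v \<noteq> 0" using assms(2) min_degree_ge_iff[OF sg] v by fastforce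
    then obtain w where w: "{v, w} \<in> edges G"
      unfolding degree_def using finite_neighbours[OF sg] by (auto simp: card_eq_0_iff)
    have wu: "w \<noteq> u" using w uv by (auto simp: insert_commute)
    have wV: "w \<in> verts G" "w \<noteq> v" using w edge_vertsD[OF sg] by blast+
    \<comment> \<open>If a neighbour \<open>a\<close> of \<open>u\<close> were not adjacent to
      \<open>w\<close>, the edges \<open>{u, a}\<close>, \<open>{w, v}\<close> and the non-edges
      \<open>{u, v}\<close>, \<open>{w, a}\<close> would form an alternating 4-cycle.\<close>
    have sub: "?N u - {w} \<subseteq> ?N w - {u, v}"
    proof
      fix a assume a: "a \<in> ?N u - {w}"
      have "a \<noteq> u" "a \<noteq> v" using a uv edge_vertsD(3)[OF sg] by auto
      moreover have "{w, a} \<in> edges G"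
      proof (rule ccontr)
        assume "{w, a} \<notin> edges G"
        then show False
          using threshold_graph_alternating[OF th, of u a w v] a uv w v wu wV \<open>a \<noteq> u\<close> \<open>a \<noteq> v\<close>
          by (auto simp: insert_commute)
      qed
      ultimately show "a \<in> ?N w - {u, v}" by blast
    qed
    have f: "finite (?N w)" "finite (?N u)" by (rule finite_neighbours[OF sg])+
    have vN: "v \<in> ?N w" using w by (simp add: insert_commute)
    \<comment> \<open>If \<open>u\<close> and \<open>w\<close> are adjacent, \<open>?N u\<close>
      loses only \<open>w\<close> in \<open>sub\<close> while \<open>?N w\<close> loses both
      \<open>u\<close> and \<open>v\<close>. Otherwise \<open>v\<close> alone makes the inclusion
      strict.\<close>
    have "card (?N u) < card (?N w)"
    proof (cases "{u, w} \<in> edges G")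
      case True
      then have "?N u = insert w (?N u - {w})" by auto
      then have "card (?N u) = Suc (card (?N u - {w}))"
        using f by (metis Diff_iff card_insert_disjoint finite_Diff insertI1)
      also have "\<dots> \<le> Suc (card (?N w - {u, v}))"
        using card_mono[OF _ sub] f by simp
      also have "card (?N w - {u, v}) = card (?N w) - 2"
        using True vN v by (subst card_Diff_subset) (auto simp: insert_commute)
      also have "Suc (card (?N w) - 2) < card (?N w)"
        using card_mono[of "?N w" "{u, v}"] f True vN v by (auto simp: insert_commute)
      finally show ?thesis .
    next
      case False
      then have "?N u \<subseteq> ?N w - {u, v}" using sub by auto
      then have "?N u \<subset> ?N w" using vN by auto
      then show ?thesis using f by (simp add: psubset_card_mono)
    qed
    then show False using u(2)[OF wV(1)] by (simp add: degree_def)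
  qed
  then show ?thesis using u(1) that by blast
qed

lemma is_starI:
  assumes "finite (verts G)" "u \<in> verts G"
    "\<And>x y. x \<in> verts G \<Longrightarrow> y \<in> verts G \<Longrightarrow>
      {x, y} \<in> edges G \<longleftrightarrow> (x = u \<and> y \<noteq> u \<or> x \<noteq> u \<and> y = u)"
  shows "is_star G"
proof -
  let ?m = "card (verts G - {u})"
  obtain h where h: "bij_betw h (verts G - {u}) {1..?m}"
    using ex_bij_betw_nat_finite_1[of "verts G - {u}"] assms(1) bij_betw_inv by blast
  define f where "f v = (if v = u then 0 else h v)" for v
  have b1: "bij_betw f (verts G - {u}) {1..?m}"
    using h by (subst bij_betw_cong[of _ _ h]) (auto simp: f_def)
  have "bij_betw f {u} {0}" by (simp add: f_def bij_betw_def)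
  then have "bij_betw f ((verts G - {u}) \<union> {u}) ({1..?m} \<union> {0})"
    using b1 by (intro bij_betw_combine) auto
  moreover have "(verts G - {u}) \<union> {u} = verts G" "{1..?m} \<union> {0} = {0..?m}"
    using assms(2) by auto
  ultimately have b: "bij_betw f (verts G) (verts (star ?m))" by (simp add: star_def)
  have pos: "f v \<in> {1..?m}" if "v \<in> verts G" "v \<noteq> u" for v
    using b1 that unfolding bij_betw_def by blast
  have fu: "f u = 0" by (simp add: f_def)
  have "{x, y} \<in> edges G \<longleftrightarrow> {f x, f y} \<in> edges (star ?m)"
    if "x \<in> verts G" "y \<in> verts G" for x y
  proof -
    have "f x = 0 \<longleftrightarrow> x = u" "f y = 0 \<longleftrightarrow> y = u" "f x \<le> ?m" "f y \<le> ?m"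
      using pos[OF that(1)] pos[OF that(2)] fu by (cases "x = u"; cases "y = u"; fastforce)+
    then show ?thesis
      unfolding assms(3)[OF that] star_def by (auto simp: doubleton_eq_iff)
  qed
  then show ?thesis using b unfolding is_star_def graph_iso_def by blast
qed

section \<open>The convex sets\<close>

definition leaves :: "'a graph \<Rightarrow> 'a set" where
  "leaves G = {v \<in> verts G. degree G v = 1}"

text \<open>
  With \<open>u\<close> universal, the leaves are the isolated vertices of \<open>G - u\<close>, and \<open>core G u\<close> consists of
  the other ones.
\<close>

definition core :: "'a graph \<Rightarrow> 'a \<Rightarrow> 'a set" where
  "core G u = {v. v \<noteq> u \<and> (\<exists>w. w \<noteq> u \<and> {v, w} \<in> edges G)}"

text \<open>Only the end points must be distinct: a middle vertex equal to one of them lies in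
  \<open>C\<close> anyway.\<close>

lemma P3_convexD:
  assumes "P3_convex G C" "x \<in> C" "y \<in> C" "x \<noteq> y" "{x, z} \<in> edges G" "{z, y} \<in> edges G"
  shows "z \<in> C"
proof (cases "z = x \<or> z = y")
  case False
  then have "distinct [x, z, y]" using assms(4) by auto
  then show ?thesis using assms unfolding P3_convex_def by blast
qed (use assms in blast)

text \<open>A fixed universal vertex stands in for the assumption on the minimum degree.\<close>

locale nonstar_threshold =
  fixes G :: "'a graph" and u :: 'a
  assumes threshold: "threshold_graph G"
    and nonstar: "\<not> is_star G"
    and u_vert: "u \<in> verts G"
    and universal: "\<And>v. v \<in> verts G \<Longrightarrow> v \<noteq> u \<Longrightarrow> {u, v} \<in> edges G"
begin

lemma universal':
  assumes "v \<in> verts G" "v \<noteq> u" shows "{v, u} \<in> edges G"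
  using universal[OF assms] by (simp add: insert_commute)

lemma simple: "simple_graph G"
  using threshold by (simp add: threshold_graph_def)

lemma finite_verts: "finite (verts G)"
  using simple by (simp add: simple_graph_def)

lemma core_subset: "core G u \<subseteq> verts G" "u \<notin> core G u"
  using edge_vertsD(1)[OF simple] by (auto simp: core_def)

text \<open>If every edge met \<open>u\<close>, then \<open>G\<close> would be a star with centre
  \<open>u\<close>.\<close>

lemma core_edge: obtains q r where "q \<in> core G u" "r \<in> core G u" "{q, r} \<in> edges G" "q \<noteq> r"
proof -
  have "\<exists>q r. q \<noteq> u \<and> r \<noteq> u \<and> {q, r} \<in> edges G"
  proof (rule ccontr)
    assume none: "\<not> ?thesis"
    have "is_star G"
    proof (rule is_starI[OF finite_verts u_vert])
      fix x y assume "x \<in> verts G" "y \<in> verts G"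
      then show "{x, y} \<in> edges G \<longleftrightarrow> (x = u \<and> y \<noteq> u \<or> x \<noteq> u \<and> y = u)"
        using none universal[of x] universal[of y] edge_vertsD(3)[OF simple, of x y]
        by (auto simp: insert_commute)
    qed
    then show False using nonstar by contradiction
  qed
  then obtain q r where qr: "q \<noteq> u" "r \<noteq> u" "{q, r} \<in> edges G" by blast
  then have "{r, q} \<in> edges G" by (simp add: insert_commute)
  then have "q \<in> core G u" "r \<in> core G u" using qr unfolding core_def by blast+
  then show ?thesis using that qr edge_vertsD(3)[OF simple] by blast
qed

lemma neighbours_leaf:
  assumes "v \<in> leaves G"
  shows "v \<noteq> u" "{w. {v, w} \<in> edges G} = {u}"
proof -
  obtain a where a: "{w. {v, w} \<in> edges G} = {a}"
    using assms unfolding leaves_def degree_def by (auto simp: card_1_singleton_iff)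
  show "v \<noteq> u"
  proof
    assume "v = u"
    \<comment> \<open>The ends of a core edge are two neighbours of \<open>u\<close>, so
      \<open>u\<close> is not a leaf.\<close>
    obtain q r where "q \<in> core G u" "r \<in> core G u" "q \<noteq> r" using core_edge by blast
    then have "q \<in> {w. {v, w} \<in> edges G}" "r \<in> {w. {v, w} \<in> edges G}"
      using universal core_subset \<open>v = u\<close> by blast+
    then show False using a \<open>q \<noteq> r\<close> by simp
  qed
  moreover have "v \<in> verts G" using assms by (simp add: leaves_def)
  ultimately have "u \<in> {w. {v, w} \<in> edges G}"
    using universal' by simp
  then show "{w. {v, w} \<in> edges G} = {u}" using a by simp
qed

lemma leaf_edge:
  assumes "v \<in> leaves G" "{v, w} \<in> edges G" shows "w = u"
  using assms neighbours_leaf(2) by auto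

lemma verts_eq: "verts G = insert u (core G u \<union> leaves G)"
proof
  show "insert u (core G u \<union> leaves G) \<subseteq> verts G"
    using core_subset u_vert by (auto simp: leaves_def)
  show "verts G \<subseteq> insert u (core G u \<union> leaves G)"
  proof
    fix v assume v: "v \<in> verts G"
    show "v \<in> insert u (core G u \<union> leaves G)"
    proof (cases "v = u \<or> v \<in> core G u")
      case False
      then have "{w. {v, w} \<in> edges G} = {u}"
        using universal'[OF v] by (auto simp: core_def)
      then show ?thesis using v by (simp add: leaves_def degree_def)
    qed auto
  qed
qed

lemma leaves_disjoint: "u \<notin> leaves G" "core G u \<inter> leaves G = {}"
  using neighbours_leaf unfolding core_def by blast+

text \<open>For \<open>r\<close> other than \<open>u\<close>, the vertex \<open>r\<close> is the
  middle of the path from \<open>q\<close> to \<open>u\<close>, whose ends lie in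
  \<open>C\<close>.\<close>

lemma convex_closed_core:
  assumes "P3_convex G C" "u \<in> C" "q \<in> C" "q \<in> core G u" "{q, r} \<in> edges G"
  shows "r \<in> C"
proof (cases "r = u")
  case False
  have "r \<in> verts G" using edge_vertsD[OF simple assms(5)] by blast
  then have "{r, u} \<in> edges G" using universal' False by simp
  moreover have "q \<noteq> u" using assms(4) by (simp add: core_def)
  ultimately show ?thesis using P3_convexD[OF assms(1,3,2) _ assms(5)] by simp
qed (use assms in simp)

lemma convex_contains_core:
  assumes C: "P3_convex G C" "u \<in> C" "q \<in> C" "q \<in> core G u"
  shows "core G u \<subseteq> C"
proof
  fix p assume p: "p \<in> core G u"
  then obtain s where s: "s \<noteq> u" "{p, s} \<in> edges G" unfolding core_def by blast
  then have sp: "{s, p} \<in> edges G" by (simp add: insert_commute)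
  then have sc: "s \<in> core G u" using p s unfolding core_def by blast
  obtain r where r: "r \<noteq> u" "{q, r} \<in> edges G" using C(4) unfolding core_def by blast
  then have "{r, q} \<in> edges G" by (simp add: insert_commute)
  then have rc: "r \<in> core G u" using C(4) r unfolding core_def by blast
  note closed = convex_closed_core[OF C(1,2)]
  have rC: "r \<in> C" using closed[OF C(3,4) r(2)] .
  show "p \<in> C"
  proof (rule ccontr)
    assume pC: "p \<notin> C"
    then have sC: "s \<notin> C" using closed[of s p] sc sp by blast
    \<comment> \<open>The edge \<open>{q, r}\<close> lies inside \<open>C\<close> and
      \<open>{p, s}\<close> outside. An edge between them would carry membership across by
      \<open>closed\<close>, so the two edges induce a \<open>two_K2\<close>.\<close>
    have "{q, p} \<notin> edges G" "{q, s} \<notin> edges G" "{r, p} \<notin> edges G" "{r, s} \<notin> edges G"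
      using closed C(3,4) rc rC pC sC by blast+
    moreover have "distinct [q, r, p, s]"
      using edge_vertsD(3)[OF simple] r s C(3) rC pC sC by auto
    ultimately show False using threshold_graph_not_two_K2[OF threshold] r s by blast
  qed
qed

section \<open>Classification and number of the convex sets\<close>

lemma convex_singleton:
  assumes "v \<in> verts G" shows "P3_convex G {v}"
  using assms by (auto simp: P3_convex_def)

text \<open>One of two distinct end points is a leaf, so the middle vertex is its only neighbour
  \<open>u\<close>.\<close>

lemma convex_insert_leaves:
  assumes "A \<subseteq> leaves G" shows "P3_convex G (insert u A)"
  unfolding P3_convex_def
proof (intro conjI allI impI)
  show "insert u A \<subseteq> verts G" using assms u_vert by (auto simp: leaves_def)
  fix x z y
  assume *: "distinct [x, z, y] \<and> {x, z} \<in> edges G \<and> {z, y} \<in> edges G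
    \<and> x \<in> insert u A \<and> y \<in> insert u A"
  then have "x \<in> leaves G \<or> y \<in> leaves G" using assms by auto
  moreover have "{x, z} \<in> edges G" "{y, z} \<in> edges G"
    using * by (simp_all add: insert_commute)
  ultimately have "z = u" using leaf_edge by blast
  then show "z \<in> insert u A" by simp
qed

text \<open>Vertices outside the set are leaves, and a leaf has too few neighbours to be the middle
  of a path.\<close>

lemma convex_insert_core_leaves:
  assumes "A \<subseteq> leaves G" shows "P3_convex G (insert u (core G u \<union> A))"
  unfolding P3_convex_def
proof (intro conjI allI impI)
  show "insert u (core G u \<union> A) \<subseteq> verts G" using assms verts_eq by blast
  fix x z y
  assume *: "distinct [x, z, y] \<and> {x, z} \<in> edges G \<and> {z, y} \<in> edges G
    \<and> x \<in> insert u (core G u \<union> A) \<and> y \<in> insert u (core G u \<union> A)"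
  then have zx: "{z, x} \<in> edges G" "{z, y} \<in> edges G" by (simp_all add: insert_commute)
  then have "z \<in> verts G" using edge_vertsD(1)[OF simple] by blast
  moreover have "z \<notin> leaves G"
  proof
    assume "z \<in> leaves G"
    then have "x = u" "y = u" using leaf_edge zx by blast+
    then show False using * by simp
  qed
  ultimately show "z \<in> insert u (core G u \<union> A)" using verts_eq by blast
qed

lemma convex_cases:
  assumes C: "P3_convex G C" and ne: "C \<noteq> {}" "\<And>v. C \<noteq> {v}"
  shows "u \<in> C" "core G u \<inter> C = {} \<or> core G u \<subseteq> C"
proof -
  obtain x where x: "x \<in> C" using ne(1) by blast
  then obtain y where y: "y \<in> C" "x \<noteq> y" using ne(2)[of x] by blast
  note xy = x y
  have V: "C \<subseteq> verts G" using C by (simp add: P3_convex_def)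
  show u: "u \<in> C"
  proof (rule ccontr)
    assume "u \<notin> C"
    then have "{x, u} \<in> edges G" "{u, y} \<in> edges G"
      using xy V universal universal' by blast+
    then show False using P3_convexD[OF C xy] \<open>u \<notin> C\<close> by blast
  qed
  show "core G u \<inter> C = {} \<or> core G u \<subseteq> C"
    using convex_contains_core[OF C u] by blast
qed

lemma convex_sets:
  "{C. P3_convex G C} = insert {} ((\<lambda>v. {v}) ` (core G u \<union> leaves G))
     \<union> (insert u ` Pow (leaves G) \<union> (\<lambda>A. insert u (core G u \<union> A)) ` Pow (leaves G))"
  (is "?L = ?R")
proof
  show "?L \<subseteq> ?R"
  proof
    fix C assume "C \<in> ?L"
    then have C: "P3_convex G C" by simp
    then have V: "C \<subseteq> verts G" by (simp add: P3_convex_def)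
    show "C \<in> ?R"
    proof (cases "C = {} \<or> (\<exists>v. C = {v})")
      case True
      \<comment> \<open>The singleton of \<open>u\<close> is counted among the sets
        \<open>insert u A\<close>, with \<open>A\<close> empty; this keeps the families
        disjoint.\<close>
      have "{u} \<in> insert u ` Pow (leaves G)" by (rule image_eqI[of _ _ "{}"]) simp_all
      moreover have "{v} \<in> (\<lambda>v. {v}) ` (core G u \<union> leaves G)" if "v \<in> verts G" "v \<noteq> u" for v
        using that verts_eq by simp
      ultimately show ?thesis using True V by blast
    next
      case False
      then have cs: "u \<in> C" "core G u \<inter> C = {} \<or> core G u \<subseteq> C"
        using convex_cases[OF C] by auto
      have "C = insert u (C \<inter> leaves G) \<or> C = insert u (core G u \<union> (C \<inter> leaves G))"
        using cs V unfolding verts_eq by blast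
      then show ?thesis by blast
    qed
  qed
  have "P3_convex G {}" by (simp add: P3_convex_def)
  moreover have "P3_convex G {v}" if "v \<in> core G u \<union> leaves G" for v
    using that convex_singleton verts_eq by simp
  ultimately show "?R \<subseteq> ?L"
    using convex_insert_leaves convex_insert_core_leaves by blast
qed

lemma noc_eq: "noc G = card (verts G) + 2 ^ (card (leaves G) + 1)"
proof -
  have fin: "finite (core G u)" "finite (leaves G)"
    using finite_verts unfolding verts_eq by simp_all
  obtain q r where qr: "q \<in> core G u" "r \<in> core G u" "q \<noteq> r" using core_edge by blast
  let ?A = "insert {} ((\<lambda>v. {v}) ` (core G u \<union> leaves G))"
  let ?B = "insert u ` Pow (leaves G)"
  let ?C = "(\<lambda>A. insert u (core G u \<union> A)) ` Pow (leaves G)"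
  have notu: "u \<notin> core G u" "u \<notin> leaves G" using core_subset leaves_disjoint by blast+
  \<comment> \<open>The empty set makes up for the missing singleton of \<open>u\<close>, so that
    \<open>?A\<close> has as many members as there are vertices.\<close>
  have "card ?A = Suc (card (core G u \<union> leaves G))"
    using fin by (subst card_insert_disjoint) (auto simp: card_image)
  also have "\<dots> = card (verts G)" using fin notu unfolding verts_eq by simp
  finally have A: "card ?A = card (verts G)" .
  \<comment> \<open>In both families \<open>A\<close> is recovered by intersecting with the set of
    leaves.\<close>
  have "inj_on (insert u) (Pow (leaves G))"
    by (rule inj_on_inverseI[of _ "\<lambda>B. B \<inter> leaves G"]) (use notu in auto)
  moreover have "inj_on (\<lambda>A. insert u (core G u \<union> A)) (Pow (leaves G))"
    by (rule inj_on_inverseI[of _ "\<lambda>B. B \<inter> leaves G"]) (use notu leaves_disjoint in auto)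
  ultimately have B: "card ?B = 2 ^ card (leaves G)" and C: "card ?C = 2 ^ card (leaves G)"
    using fin by (simp_all add: card_image card_Pow)
  \<comment> \<open>The core vertex \<open>q\<close> separates \<open>?B\<close> from
    \<open>?C\<close>; below, \<open>u\<close> separates both from \<open>?A\<close>.\<close>
  have "q \<notin> B" if "B \<in> ?B" for B using that qr(1) notu leaves_disjoint by auto
  moreover have "q \<in> B" if "B \<in> ?C" for B using that qr(1) by auto
  ultimately have "?B \<inter> ?C = {}" by blast
  then have BC: "card (?B \<union> ?C) = 2 ^ (card (leaves G) + 1)"
    using fin by (subst card_Un_disjoint) (simp_all add: B C)
  have "u \<notin> B" if "B \<in> ?A" for B using that notu by auto
  moreover have "u \<in> B" if "B \<in> ?B \<union> ?C" for B using that by auto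
  ultimately have "?A \<inter> (?B \<union> ?C) = {}" by blast
  moreover have "finite ?A" "finite (?B \<union> ?C)" using fin by simp_all
  ultimately have "card (?A \<union> (?B \<union> ?C)) = card ?A + card (?B \<union> ?C)"
    by (intro card_Un_disjoint)
  then show ?thesis unfolding noc_def convex_sets A BC .
qed

end

section \<open>The count in terms of a canonical split partition\<close>

lemma nonstar_thresholdE:
  assumes "threshold_graph G" "min_degree G \<ge> 1" "\<not> is_star G"
  obtains u where "nonstar_threshold G u"
proof (rule threshold_graph_universal_vertex[OF assms(1,2)])
  fix u assume u: "u \<in> verts G" "\<And>v. v \<in> verts G \<Longrightarrow> v \<noteq> u \<Longrightarrow> {u, v} \<in> edges G"
  show thesis by (rule that, rule nonstar_threshold.intro[OF assms(1,3) u])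
qed

lemma noc_threshold:
  assumes "threshold_graph G" "min_degree G \<ge> 1" "\<not> is_star G"
  shows "noc G = card (verts G) + 2 ^ (card (leaves G) + 1)"
  by (rule nonstar_thresholdE[OF assms]) (rule nonstar_threshold.noc_eq)

text \<open>A core edge forms a triangle with \<open>u\<close>, so a maximum clique has at least
  three vertices. A leaf in \<open>K\<close> would leave room for only \<open>u\<close> besides it;
  hence all leaves lie in \<open>S\<close>.\<close>

lemma (in nonstar_threshold) canonical_leaves:
  assumes "canonical_split_partition G K S"
  shows "{s \<in> S. degree G s = 1} = leaves G"
proof -
  have KS: "K \<union> S = verts G" "clique G K" "card K = clique_number G"
    using assms by (auto simp: canonical_split_partition_def split_partition_def)
  obtain q r where qr: "q \<in> core G u" "r \<in> core G u" "{q, r} \<in> edges G" "q \<noteq> r"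
    using core_edge by blast
  have qrV: "q \<in> verts G" "q \<noteq> u" "r \<in> verts G" "r \<noteq> u" using qr core_subset by blast+
  then have "clique G {u, q, r}"
    using qr(3) u_vert universal universal' insert_commute[of q r "{}"]
    unfolding clique_def by simp
  moreover have "finite {K. clique G K}"
    by (rule finite_subset[of _ "Pow (verts G)"]) (auto simp: clique_def finite_verts)
  ultimately have "card {u, q, r} \<le> clique_number G"
    unfolding clique_number_def by (intro Max_ge) auto
  then have K3: "3 \<le> card K" using KS(3) qr(4) qrV by simp
  have "k \<notin> leaves G" if "k \<in> K" for k
  proof
    assume k: "k \<in> leaves G"
    have "K - {k} \<subseteq> {u}"
    proof
      fix w assume "w \<in> K - {k}"
      then have "{k, w} \<in> edges G" using KS(2) that unfolding clique_def by auto
      then show "w \<in> {u}" using leaf_edge[OF k] by simp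
    qed
    then have "card (K - {k}) \<le> 1" using card_mono[of "{u}"] by simp
    then show False using K3 that by simp
  qed
  then show ?thesis using KS(1) unfolding leaves_def by blast
qed

text \<open>With \<open>d\<close> leaves, \<open>2 ^ (d + 1)\<close> splits as
  \<open>1 + (2 ^ d - 1) + 2 ^ d\<close>. If the minimum degree is at least 2, then
  \<open>d = 0\<close> and the middle term vanishes.\<close>

lemma noc_canonical:
  assumes "threshold_graph G" "min_degree G \<ge> 1" "\<not> is_star G"
    "canonical_split_partition G K S" and S1: "S1 = {s \<in> S. degree G s = 1}"
  shows "noc G = (card S + 1) + card K
    + (if min_degree G \<ge> 2 then 0 else 2 ^ card S1 - 1) + 2 ^ card S1"
proof -
  obtain u where "nonstar_threshold G u" using nonstar_thresholdE assms by blast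
  then interpret nonstar_threshold G u .
  have S1_leaves: "S1 = leaves G" using canonical_leaves[OF assms(4)] S1 by simp
  have KS: "K \<union> S = verts G" "K \<inter> S = {}"
    using assms(4) by (auto simp: canonical_split_partition_def split_partition_def)
  then have "card (verts G) = card K + card S"
    using finite_verts card_Un_disjoint by (metis finite_Un)
  moreover have "leaves G = {}" if "min_degree G \<ge> 2"
    using that min_degree_ge_iff[OF simple, of 2] unfolding leaves_def by auto
  moreover have "(1 :: nat) \<le> 2 ^ card S1" by simp
  ultimately show ?thesis unfolding noc_eq S1_leaves by auto
qed

section \<open>Counting the convex sets on a random access machine\<close>

definition bounded :: "nat \<Rightarrow> config \<Rightarrow> bool" where
  "bounded W s \<longleftrightarrow> (\<forall>i. regs s i \<le> W \<and> mem s i \<le> W)"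

text \<open>Counts steps exactly and records the word bound at every configuration. Peeling off the
  first instruction suits symbolic execution, and the segments of a program are composed by
  \<open>run_trans\<close>.\<close>

inductive run :: "instr list \<Rightarrow> nat \<Rightarrow> nat \<Rightarrow> config \<Rightarrow> config \<Rightarrow> bool" for P W where
  run_refl: "bounded W s \<Longrightarrow> run P W 0 s s"
| run_step: "bounded W s \<Longrightarrow> pc s < length P \<Longrightarrow> run P W t (exec (P ! pc s) s) s'
    \<Longrightarrow> run P W (Suc t) s s'"

lemma run_trans:
  assumes "run P W t s s'" "run P W t' s' s''"
  shows "run P W (t + t') s s''"
  using assms by (induction rule: run.induct) (auto intro: run_step)

lemma run_bounded: "run P W t s s' \<Longrightarrow> bounded W s \<and> bounded W s'"
  by (induction rule: run.induct) auto

lemma run_funpow: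
  assumes "run P W t s s'"
  shows "(step P ^^ t) s = s' \<and> (\<forall>k\<le>t. bounded W ((step P ^^ k) s))"
  using assms
proof (induction rule: run.induct)
  case (run_step s t s')
  have s: "exec (P ! pc s) s = step P s"
    using run_step.hyps by (simp add: step_def halted_def)
  have "bounded W ((step P ^^ k) s)" if "k \<le> Suc t" for k
    using that run_step unfolding s by (cases k) (simp_all add: funpow_swap1)
  then show ?case using run_step.IH unfolding s by (simp add: funpow_swap1)
qed simp

lemma run_ram_computes:
  assumes "run P W t (init_config xs) s" "halted P s" "outputs s x" "t \<le> T"
  shows "ram_computes P xs x T W"
  using run_funpow[OF assms(1)] assms(2-) unfolding ram_computes_def bounded_def by blast

text \<open>Constants, sums and products are the only new values that can exceed the word bound.\<close>

fun fits :: "nat \<Rightarrow> instr \<Rightarrow> config \<Rightarrow> bool" where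
  "fits W (Const r k) s \<longleftrightarrow> k \<le> W"
| "fits W (Arith Plus r a b) s \<longleftrightarrow> regs s a + regs s b \<le> W"
| "fits W (Arith Times r a b) s \<longleftrightarrow> regs s a * regs s b \<le> W"
| "fits W _ s \<longleftrightarrow> True"

lemma bounded_exec:
  assumes "bounded W s" "fits W i s"
  shows "bounded W (exec i s)"
proof (cases i)
  case (Arith f r a b)
  have "x - y \<le> W" "x div y \<le> W" if "x \<le> W" for x y :: nat
    using that by (simp_all add: le_trans[OF div_le_dividend])
  then show ?thesis using assms Arith by (cases f) (auto simp: bounded_def)
qed (use assms in \<open>auto simp: bounded_def\<close>)

text \<open>The rule of symbolic execution: once the new value fits, the word bound of the next
  configuration is available as a hypothesis for the rest of the run.\<close>

lemma run_exec:
  assumes "bounded W s" "pc s < length P" "fits W (P ! pc s) s"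
    "bounded W (exec (P ! pc s) s) \<Longrightarrow> run P W t (exec (P ! pc s) s) s'"
  shows "run P W (Suc t) s s'"
  using assms bounded_exec by (blast intro: run_step)

text \<open>The same rule for step counts written as numerals.\<close>

lemma run_exec_numeral:
  assumes "bounded W s" "pc s < length P" "fits W (P ! pc s) s"
    "bounded W (exec (P ! pc s) s) \<Longrightarrow> run P W (pred_numeral k) (exec (P ! pc s) s) s'"
  shows "run P W (numeral k) s s'"
  unfolding numeral_eq_Suc using assms by (rule run_exec)

text \<open>
  Lines 5 to 13 run over the vertices in descending order and add \<open>1 div deg\<close> to register 6, which
  therefore ends up as the number \<open>e\<close> of leaves plus one.  Lines 15 to 28 write the \<open>i\<close>-th bit of
  \<open>n + 2 ^ e\<close> to address \<open>i\<close>; register 9 holds the part of the number that is still to be written,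
  divided by \<open>2 ^ i\<close>, and \<open>1 - (i - e) - (e - i)\<close> tells whether \<open>2 ^ e\<close> is to be added.
  Register 1 is always 0, so \<open>Jump_zero 1\<close> is an unconditional jump.
\<close>

definition noc_program :: "instr list" where
  "noc_program =
    [Const 2 1,
     Const 3 2,
     Const 6 1,
     Load 9 1,
     Load 4 1,
     Jump_zero 4 14,
     Arith Plus 5 4 2,
     Load 5 5,
     Load 7 4,
     Arith Minus 5 5 7,
     Arith Divide 5 2 5,
     Arith Plus 6 6 5,
     Arith Minus 4 4 2,
     Jump_zero 1 5,
     Arith Plus 0 9 3,
     Arith Minus 5 0 4,
     Jump_zero 5 29,
     Arith Minus 5 4 6,
     Arith Minus 7 6 4,
     Arith Minus 5 2 5,
     Arith Minus 5 5 7,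
     Arith Plus 9 9 5,
     Arith Divide 5 9 3,
     Arith Plus 7 5 5,
     Arith Minus 7 9 7,
     Store 4 7,
     Arith Plus 9 5 1,
     Arith Plus 4 4 2,
     Jump_zero 1 15]"

lemma noc_program_length: "length noc_program = 29"
  by (simp add: noc_program_def)

text \<open>Indices below 5 are written with \<open>0\<close> and \<open>Suc\<close>, the form in
  which simplification leaves a program counter that starts at 0; the later segments start at a
  numeral.\<close>

lemma noc_program_nth:
  "noc_program ! 0 = Const 2 1"
  "noc_program ! (Suc 0) = Const 3 2"
  "noc_program ! (Suc (Suc 0)) = Const 6 1"
  "noc_program ! (Suc (Suc (Suc 0))) = Load 9 1"
  "noc_program ! (Suc (Suc (Suc (Suc 0)))) = Load 4 1"
  "noc_program ! 5 = Jump_zero 4 14"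
  "noc_program ! 6 = Arith Plus 5 4 2"
  "noc_program ! 7 = Load 5 5"
  "noc_program ! 8 = Load 7 4"
  "noc_program ! 9 = Arith Minus 5 5 7"
  "noc_program ! 10 = Arith Divide 5 2 5"
  "noc_program ! 11 = Arith Plus 6 6 5"
  "noc_program ! 12 = Arith Minus 4 4 2"
  "noc_program ! 13 = Jump_zero 1 5"
  "noc_program ! 14 = Arith Plus 0 9 3"
  "noc_program ! 15 = Arith Minus 5 0 4"
  "noc_program ! 16 = Jump_zero 5 29"
  "noc_program ! 17 = Arith Minus 5 4 6"
  "noc_program ! 18 = Arith Minus 7 6 4"
  "noc_program ! 19 = Arith Minus 5 2 5"
  "noc_program ! 20 = Arith Minus 5 5 7"
  "noc_program ! 21 = Arith Plus 9 9 5"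
  "noc_program ! 22 = Arith Divide 5 9 3"
  "noc_program ! 23 = Arith Plus 7 5 5"
  "noc_program ! 24 = Arith Minus 7 9 7"
  "noc_program ! 25 = Store 4 7"
  "noc_program ! 26 = Arith Plus 9 5 1"
  "noc_program ! 27 = Arith Plus 4 4 2"
  "noc_program ! 28 = Jump_zero 1 15"
  by (simp_all add: noc_program_def)

section \<open>Symbolic execution of the program segments and the two loops\<close>

lemma count_step:
  assumes "bounded W s" "pc s = 5" "regs s 1 = 0" "regs s 2 = 1" "regs s 4 = Suc p"
    "Suc (Suc p) \<le> W" "regs s 6 < W"
  shows "\<exists>s'. run noc_program W 9 s s' \<and> pc s' = 5 \<and> mem s' = mem s
    \<and> regs s' 1 = 0 \<and> regs s' 2 = 1 \<and> regs s' 3 = regs s 3 \<and> regs s' 4 = p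
    \<and> regs s' 6 = regs s 6 + 1 div (mem s (Suc (Suc p)) - mem s (Suc p)) \<and> regs s' 9 = regs s 9"
proof -
  have le: "regs s 6 + Suc 0 div x \<le> W" for x
    using assms(7) div_le_dividend[of "Suc 0" x] by linarith
  note simps = assms(2-) assms(3)[unfolded One_nat_def] le noc_program_nth noc_program_length
  show ?thesis
    \<comment> \<open>The final configuration stays schematic. Each round executes one instruction,
      checking program counter and word bound, and \<open>run_refl\<close> then fixes the
      configuration reached.\<close>
    apply (intro exI conjI)
     apply ((rule run_exec_numeral run_exec, (assumption | rule assms(1)),
       simp add: simps, simp add: simps, simp add: simps)+)[1]
     apply (rule run_refl, assumption)
    by (simp_all add: simps)
qed

lemma bit_step:
  assumes "bounded W s" "pc s = 15" "regs s 0 = N" "regs s 1 = 0" "regs s 2 = 1" "regs s 3 = 2"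
    "regs s 4 = i" "regs s 6 = e" "regs s 9 = q" "i < N" "N \<le> W" "q < W"
    and x: "x = (if i = e then q + 1 else q)"
  shows "\<exists>s'. run noc_program W 14 s s' \<and> pc s' = 15 \<and> mem s' = (mem s)(i := x mod 2)
    \<and> regs s' 0 = N \<and> regs s' 1 = 0 \<and> regs s' 2 = 1 \<and> regs s' 3 = 2
    \<and> regs s' 4 = Suc i \<and> regs s' 6 = e \<and> regs s' 9 = x div 2"
proof -
  \<comment> \<open>Subtraction is truncated, so the two differences add up to the distance of
    \<open>i\<close> and \<open>e\<close>.\<close>
  have x_eq: "q + (Suc 0 - (i - e + (e - i))) = x" using x by auto
  have le: "x \<le> W" "x div 2 \<le> W" "x div 2 + x div 2 \<le> W" "Suc i \<le> W" using assms(10-) by auto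
  have mod: "x - (x div 2 + x div 2) = x mod 2"
    using div_mult_mod_eq[of x 2] by linarith
  note simps = assms(2-11) assms(4)[unfolded One_nat_def] iffD2[OF not_le assms(10)] x_eq le mod noc_program_nth noc_program_length
  show ?thesis
    apply (intro exI conjI)
     apply ((rule run_exec_numeral run_exec, (assumption | rule assms(1)),
       simp add: simps, simp add: simps, simp add: simps)+)[1]
     apply (rule run_refl, assumption)
    by (simp_all add: simps)
qed

lemma init_run:
  assumes "bounded W s" "pc s = 0" "regs s = (\<lambda>_. 0)" "mem s 0 = n" "2 \<le> W"
  shows "\<exists>s'. run noc_program W 5 s s' \<and> pc s' = 5 \<and> mem s' = mem s
    \<and> regs s' 1 = 0 \<and> regs s' 2 = 1 \<and> regs s' 3 = 2 \<and> regs s' 4 = n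
    \<and> regs s' 6 = 1 \<and> regs s' 9 = n"
proof -
  have le: "Suc 0 \<le> W" using assms(5) by simp
  note simps = assms(2-) le noc_program_nth noc_program_length
  show ?thesis
    apply (intro exI conjI)
     apply ((rule run_exec_numeral run_exec, (assumption | rule assms(1)),
       simp add: simps, simp add: simps, simp add: simps)+)[1]
     apply (rule run_refl, assumption)
    by (simp_all add: simps)
qed

lemma count_exit:
  assumes "bounded W s" "pc s = 5" "regs s 3 = 2" "regs s 4 = 0" "regs s 9 = n" "n + 2 \<le> W"
  shows "\<exists>s'. run noc_program W 2 s s' \<and> pc s' = 15 \<and> mem s' = mem s \<and> regs s' 0 = n + 2
    \<and> (\<forall>r. r \<noteq> 0 \<longrightarrow> regs s' r = regs s r)"
proof -
  have le: "Suc (Suc n) \<le> W" using assms(6) by simp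
  note simps = assms(2-) le noc_program_nth noc_program_length
  show ?thesis
    apply (intro exI conjI)
     apply ((rule run_exec_numeral run_exec, (assumption | rule assms(1)),
       simp add: simps, simp add: simps, simp add: simps)+)[1]
     apply (rule run_refl, assumption)
    by (simp_all add: simps)
qed

lemma bit_exit:
  assumes "bounded W s" "pc s = 15" "regs s 0 = regs s 4"
  shows "\<exists>s'. run noc_program W 2 s s' \<and> pc s' = 29 \<and> mem s' = mem s
    \<and> regs s' 0 = regs s 0 \<and> regs s' 1 = regs s 1"
proof -
  note simps = assms(2-) noc_program_nth noc_program_length
  show ?thesis
    apply (intro exI conjI)
     apply ((rule run_exec_numeral run_exec, (assumption | rule assms(1)),
       simp add: simps, simp add: simps, simp add: simps)+)[1]
     apply (rule run_refl, assumption)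
    by (simp_all add: simps)
qed

text \<open>\<open>M (v + 2) - M (v + 1)\<close> is the length of the adjacency list of \<open>v\<close>.\<close>

lemma count_loop:
  assumes "bounded W s" "pc s = 5" "regs s 1 = 0" "regs s 2 = 1" "regs s 4 = p" "regs s 6 + p \<le> W"
    "p < W" "mem s = M"
  shows "\<exists>s'. run noc_program W (9 * p) s s' \<and> pc s' = 5 \<and> mem s' = M
    \<and> regs s' 1 = 0 \<and> regs s' 2 = 1 \<and> regs s' 3 = regs s 3 \<and> regs s' 4 = 0
    \<and> regs s' 6 = regs s 6 + (\<Sum>v<p. 1 div (M (v + 2) - M (v + 1))) \<and> regs s' 9 = regs s 9"
  using assms
proof (induction p arbitrary: s)
  case 0
  then show ?case by (intro exI[of _ s]) (simp add: run_refl)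
next
  case (Suc p)
  have "\<exists>s'. run noc_program W 9 s s' \<and> pc s' = 5 \<and> mem s' = mem s
    \<and> regs s' 1 = 0 \<and> regs s' 2 = 1 \<and> regs s' 3 = regs s 3 \<and> regs s' 4 = p
    \<and> regs s' 6 = regs s 6 + 1 div (mem s (Suc (Suc p)) - mem s (Suc p)) \<and> regs s' 9 = regs s 9"
    using Suc.prems by (intro count_step) auto
  then obtain s1 where s1: "run noc_program W 9 s s1" "pc s1 = 5" "mem s1 = M"
    "regs s1 1 = 0" "regs s1 2 = 1" "regs s1 3 = regs s 3" "regs s1 4 = p"
    "regs s1 6 = regs s 6 + 1 div (M (p + 2) - M (p + 1))" "regs s1 9 = regs s 9"
    using Suc.prems(8) by auto
  \<comment> \<open>Register 6 grows by at most 1 while the counter drops by 1, so the sum of both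
    stays within \<open>W\<close>.\<close>
  have "regs s1 6 + p \<le> W"
    using s1(8) Suc.prems(6) div_le_dividend[of 1 "M (p + 2) - M (p + 1)"] by linarith
  moreover have "bounded W s1" using run_bounded[OF s1(1)] by simp
  ultimately obtain s2 where s2: "run noc_program W (9 * p) s1 s2" "pc s2 = 5" "mem s2 = M"
    "regs s2 1 = 0" "regs s2 2 = 1" "regs s2 3 = regs s1 3" "regs s2 4 = 0"
    "regs s2 6 = regs s1 6 + (\<Sum>v<p. 1 div (M (v + 2) - M (v + 1)))" "regs s2 9 = regs s1 9"
    using Suc.IH[of s1] s1 Suc.prems(7) by auto
  have "run noc_program W (9 * Suc p) s s2" using run_trans[OF s1(1) s2(1)] by simp
  then show ?case using s1(6,8,9) s2(2-) by (intro exI[of _ s2]) simp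
qed

text \<open>The last equation is the invariant: the digits written, plus the remaining quotient
  shifted by \<open>k\<close>, give \<open>n\<close>, together with \<open>2 ^ e\<close> once
  position \<open>e\<close> is passed. The digits overwrite the input from address 0 on, after the
  degrees have been evaluated.\<close>

lemma bit_loop:
  assumes "bounded W s" "pc s = 15" "regs s 0 = N" "regs s 1 = 0" "regs s 2 = 1" "regs s 3 = 2"
    "regs s 4 = 0" "regs s 6 = e" "regs s 9 = n" "N \<le> W" "n < W" "1 \<le> n" "k \<le> N"
  shows "\<exists>s'. run noc_program W (14 * k) s s' \<and> pc s' = 15
    \<and> regs s' 0 = N \<and> regs s' 1 = 0 \<and> regs s' 2 = 1 \<and> regs s' 3 = 2 \<and> regs s' 4 = k
    \<and> regs s' 6 = e \<and> regs s' 9 \<le> n \<and> (\<forall>i<k. mem s' i \<le> 1)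
    \<and> (\<Sum>i<k. mem s' i * 2 ^ i) + regs s' 9 * 2 ^ k = n + (if e < k then 2 ^ e else 0)"
  using assms(13)
proof (induction k)
  case 0
  then show ?case using assms by (intro exI[of _ s]) (simp add: run_refl)
next
  case (Suc k)
  then obtain s1 where s1: "run noc_program W (14 * k) s s1" "pc s1 = 15"
    "regs s1 0 = N" "regs s1 1 = 0" "regs s1 2 = 1" "regs s1 3 = 2" "regs s1 4 = k" "regs s1 6 = e"
    and q: "regs s1 9 \<le> n" and bits: "\<forall>i<k. mem s1 i \<le> 1"
    and sum: "(\<Sum>i<k. mem s1 i * 2 ^ i) + regs s1 9 * 2 ^ k = n + (if e < k then 2 ^ e else 0)"
    by auto
  define x where "x = (if k = e then regs s1 9 + 1 else regs s1 9)"
  have "bounded W s1" using run_bounded[OF s1(1)] by simp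
  then obtain s2 where s2: "run noc_program W 14 s1 s2" "pc s2 = 15" "mem s2 = (mem s1)(k := x mod 2)"
    "regs s2 0 = N" "regs s2 1 = 0" "regs s2 2 = 1" "regs s2 3 = 2" "regs s2 4 = Suc k"
    "regs s2 6 = e" "regs s2 9 = x div 2"
    using bit_step[OF _ s1(2-8) refl _ assms(10) _ x_def] Suc.prems q assms(11) by auto
  have "run noc_program W (14 * Suc k) s s2" using run_trans[OF s1(1) s2(1)] by (simp add: add.commute)
  \<comment> \<open>Since \<open>n\<close> is positive, halving absorbs the possible increment by
    1.\<close>
  moreover have "x div 2 \<le> n" using q assms(12) by (auto simp: x_def)
  moreover have "\<forall>i<Suc k. mem s2 i \<le> 1" using bits by (auto simp: s2(3) less_Suc_eq)
  moreover have "(\<Sum>i<Suc k. mem s2 i * 2 ^ i) + regs s2 9 * 2 ^ Suc k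
    = n + (if e < Suc k then 2 ^ e else 0)"
  proof -
    have "(\<Sum>i<Suc k. mem s2 i * 2 ^ i) = (\<Sum>i<k. mem s1 i * 2 ^ i) + x mod 2 * 2 ^ k"
      by (simp add: s2(3))
    moreover have "regs s2 9 * 2 ^ Suc k = x div 2 * 2 * 2 ^ k" by (simp add: s2(10))
    ultimately have "(\<Sum>i<Suc k. mem s2 i * 2 ^ i) + regs s2 9 * 2 ^ Suc k
      = (\<Sum>i<k. mem s1 i * 2 ^ i) + (x div 2 * 2 + x mod 2) * 2 ^ k"
      by (simp only: add_mult_distrib add_ac)
    also have "\<dots> = (\<Sum>i<k. mem s1 i * 2 ^ i) + x * 2 ^ k" by simp
    also have "\<dots> = (\<Sum>i<k. mem s1 i * 2 ^ i) + regs s1 9 * 2 ^ k + (if k = e then 2 ^ k else 0)"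
      by (simp add: x_def)
    also have "\<dots> = n + (if e < Suc k then 2 ^ e else 0)" unfolding sum by auto
    finally show ?thesis .
  qed
  ultimately show ?case using s2(2,4-10) by (intro exI[of _ s2]) simp
qed

text \<open>The time is the sum of 5 steps of initialization, \<open>9 * n\<close> for the degrees,
  2 for the exit, 14 for each of \<open>n + 2\<close> digits, and 2 for the final exit.\<close>

lemma noc_program_correct:
  fixes xs :: "nat list" and n :: nat
  defines "M \<equiv> mem (init_config xs)"
  defines "e \<equiv> 1 + (\<Sum>v<n. 1 div (M (v + 2) - M (v + 1)))"
  assumes "M 0 = n" "1 \<le> n" and M: "\<And>i. M i \<le> W" and W: "n + 2 \<le> W"
  shows "ram_computes noc_program xs (n + 2 ^ e) (23 * n + 37) W"
proof -
  have b0: "bounded W (init_config xs)"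
    using M unfolding M_def by (simp add: bounded_def init_config_def)
  \<comment> \<open>Every summand is at most 1, so \<open>e\<close> is less than the number of
    digits and \<open>2 ^ e\<close> does get added.\<close>
  have "(\<Sum>v<n. 1 div (M (v + 2) - M (v + 1))) \<le> (\<Sum>v<n. 1)"
    by (rule sum_mono) (rule div_le_dividend)
  then have e: "e \<le> n + 1" by (simp add: e_def)
  have "\<exists>s'. run noc_program W 5 (init_config xs) s' \<and> pc s' = 5 \<and> mem s' = mem (init_config xs)
    \<and> regs s' 1 = 0 \<and> regs s' 2 = 1 \<and> regs s' 3 = 2 \<and> regs s' 4 = n
    \<and> regs s' 6 = 1 \<and> regs s' 9 = n"
    by (rule init_run[OF b0]) (use assms in \<open>simp_all add: init_config_def\<close>)
  then obtain s1 where s1: "run noc_program W 5 (init_config xs) s1" "pc s1 = 5" "mem s1 = M"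
    "regs s1 1 = 0" "regs s1 2 = 1" "regs s1 3 = 2" "regs s1 4 = n" "regs s1 6 = 1" "regs s1 9 = n"
    unfolding M_def by blast
  have b1: "bounded W s1" using run_bounded[OF s1(1)] by simp
  obtain s2 where s2: "run noc_program W (9 * n) s1 s2" "pc s2 = 5"
    "regs s2 1 = 0" "regs s2 2 = 1" "regs s2 3 = 2" "regs s2 4 = 0" "regs s2 6 = e" "regs s2 9 = n"
    using count_loop[OF b1 s1(2,4,5,7) _ _ s1(3)] s1(6,8,9) W unfolding e_def by auto
  have b2: "bounded W s2" using run_bounded[OF s2(1)] by simp
  obtain s3 where s3: "run noc_program W 2 s2 s3" "pc s3 = 15" "regs s3 0 = n + 2"
    "\<forall>r. r \<noteq> 0 \<longrightarrow> regs s3 r = regs s2 r"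
    using count_exit[OF b2 s2(2,5,6,8) W] by blast
  have b3: "bounded W s3" using run_bounded[OF s3(1)] by simp
  have "\<exists>s'. run noc_program W (14 * (n + 2)) s3 s' \<and> pc s' = 15
    \<and> regs s' 0 = n + 2 \<and> regs s' 1 = 0 \<and> regs s' 2 = 1 \<and> regs s' 3 = 2 \<and> regs s' 4 = n + 2
    \<and> regs s' 6 = e \<and> regs s' 9 \<le> n \<and> (\<forall>i<n + 2. mem s' i \<le> 1)
    \<and> (\<Sum>i<n + 2. mem s' i * 2 ^ i) + regs s' 9 * 2 ^ (n + 2) = n + (if e < n + 2 then 2 ^ e else 0)"
    by (rule bit_loop[OF b3 s3(2,3)]) (use s3(4) s2 assms(4) W in simp_all)
  then obtain s4 where s4: "run noc_program W (14 * (n + 2)) s3 s4" "pc s4 = 15"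
    "regs s4 0 = n + 2" "regs s4 1 = 0" "regs s4 4 = n + 2" "\<forall>i<n + 2. mem s4 i \<le> 1"
    and sum: "(\<Sum>i<n + 2. mem s4 i * 2 ^ i) + regs s4 9 * 2 ^ (n + 2) = n + 2 ^ e"
    using e by auto
  have b4: "bounded W s4" using run_bounded[OF s4(1)] by simp
  obtain s5 where s5: "run noc_program W 2 s4 s5" "pc s5 = 29" "mem s5 = mem s4"
    "regs s5 0 = n + 2" "regs s5 1 = 0"
    using bit_exit[OF b4 s4(2)] s4(3,4,5) by auto
  \<comment> \<open>The result is below \<open>2 ^ (n + 2)\<close>, so nothing remains in register 9
    after \<open>n + 2\<close> digits.\<close>
  have "(2 :: nat) ^ e \<le> 2 ^ (n + 1)" using e by (intro power_increasing) auto
  then have "n + 2 ^ e < 2 ^ n + 2 ^ (n + 1)" by (intro add_less_le_mono less_exp)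
  also have "\<dots> \<le> (2 :: nat) ^ (n + 2)" by simp
  finally have "n + 2 ^ e < 2 ^ (n + 2)" .
  then have "regs s4 9 * 2 ^ (n + 2) < 1 * 2 ^ (n + 2)" using sum by linarith
  then have "regs s4 9 = 0" by (simp del: power_Suc)
  then have "n + 2 ^ e = (\<Sum>i<n + 2. mem s5 i * 2 ^ i)" using sum s5(3) by simp
  then have "outputs s5 (n + 2 ^ e)" using s4(6) s5 by (simp add: outputs_def)
  moreover have "halted noc_program s5" using s5(2) by (simp add: halted_def noc_program_length)
  moreover note run_trans[OF s1(1) run_trans[OF s2(1) run_trans[OF s3(1) run_trans[OF s4(1) s5(1)]]]]
  ultimately show ?thesis by (elim run_ram_computes) simp_all
qed

section \<open>The input encoding and the degree sum\<close>

lemma encode_zero: "mem (init_config (encode adj)) 0 = length adj"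
  by (simp add: init_config_def encode_def)

lemma encode_address:
  assumes "i \<le> length adj"
  shows "mem (init_config (encode adj)) (Suc i) = length adj + 2 + (\<Sum>j<i. length (adj ! j))"
  using assms by (simp add: init_config_def encode_def nth_append del: upt_Suc)

text \<open>The bound is the last address. Earlier addresses are partial sums, and list entries are
  vertices, hence below \<open>length adj\<close>.\<close>

lemma encode_bound:
  assumes "adjacency_lists G adj" "simple_graph G"
  shows "mem (init_config (encode adj)) i \<le> length adj + 2 + (\<Sum>j<length adj. length (adj ! j))"
    (is "_ \<le> ?B")
proof -
  have "y \<le> ?B" if y: "y \<in> set (encode adj)" for y
  proof -
    consider "y = length adj" | k where "k \<le> length adj" "y = length adj + 2 + (\<Sum>j<k. length (adj ! j))"
      | l where "l \<in> set adj" "y \<in> set l"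
      using y by (auto simp: encode_def less_Suc_eq_le simp del: upt_Suc)
    then show ?thesis
    proof cases
      case (2 k)
      have "(\<Sum>j<k. length (adj ! j)) \<le> (\<Sum>j<length adj. length (adj ! j))"
        using 2(1) by (intro sum_mono2) auto
      then show ?thesis using 2(2) by simp
    next
      case (3 l)
      then obtain v where "v < length adj" "y \<in> set (adj ! v)" by (auto simp: in_set_conv_nth)
      then have "{v, y} \<in> edges G" using assms(1) unfolding adjacency_lists_def by blast
      then have "y \<in> verts G" by (rule edge_vertsD(2)[OF assms(2)])
      then show ?thesis using assms(1) by (simp add: adjacency_lists_def)
    qed simp
  qed
  then show ?thesis by (simp add: init_config_def)
qed

lemma adjacency_lists_degree:
  assumes "adjacency_lists G adj" "v < length adj"
  shows "length (adj ! v) = degree G v"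
  using assms unfolding adjacency_lists_def degree_def by (metis distinct_card)

text \<open>Double counting: the degree sum counts ordered pairs of adjacent vertices, and each edge
  yields at most two of them.\<close>

lemma sum_degree_le:
  assumes "simple_graph G"
  shows "(\<Sum>v\<in>verts G. degree G v) \<le> 2 * card (edges G)"
proof -
  have fin: "finite (verts G)" using assms by (simp add: simple_graph_def)
  have "edges G \<subseteq> Pow (verts G)" using assms by (auto simp: simple_graph_def)
  then have finE: "finite (edges G)" using fin by (meson finite_Pow_iff finite_subset)
  let ?X = "SIGMA v : verts G. {w. {v, w} \<in> edges G}"
  have X: "(\<Sum>v\<in>verts G. degree G v) = card ?X"
    unfolding degree_def by (rule card_SigmaI[OF fin, symmetric]) (simp add: finite_neighbours[OF assms])
  have two: "finite {(v, w). {v, w} = d} \<and> card {(v, w). {v, w} = d} \<le> 2" if "d \<in> edges G" for d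
  proof -
    have "\<exists>x\<in>verts G. \<exists>y\<in>verts G. x \<noteq> y \<and> d = {x, y}"
      using assms that by (simp add: simple_graph_def)
    then obtain x y where d: "d = {x, y}" by auto
    have sub: "{(v, w). {v, w} = d} \<subseteq> {(x, y), (y, x)}"
      unfolding d by (auto simp: doubleton_eq_iff)
    have "card {(v, w). {v, w} = d} \<le> card {(x, y), (y, x)}"
      by (rule card_mono[OF _ sub]) simp
    also have "\<dots> \<le> 2" using card_length[of "[(x, y), (y, x)]"] by simp
    finally show ?thesis using finite_subset[OF sub] by simp
  qed
  have "finite (\<Union>d\<in>edges G. {(v, w). {v, w} = d})" using finE two by simp
  moreover have "?X \<subseteq> (\<Union>d\<in>edges G. {(v, w). {v, w} = d})" by auto
  ultimately have "card ?X \<le> card (\<Union>d\<in>edges G. {(v, w). {v, w} = d})" by (rule card_mono)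
  also have "\<dots> \<le> (\<Sum>d\<in>edges G. card {(v, w). {v, w} = d})" by (rule card_UN_le[OF finE])
  also have "\<dots> \<le> (\<Sum>d\<in>edges G. 2)" using two by (intro sum_mono) blast
  finally show ?thesis
    unfolding X by simp
qed

lemma noc_linear_time:
  "linear_time_computable (\<lambda>G. threshold_graph G \<and> min_degree G \<ge> 1 \<and> \<not> is_star G) noc"
  unfolding linear_time_computable_def
\<comment> \<open>As \<open>n\<close> is at least 1, \<open>23 * n + 37\<close> is at most
  \<open>60 * n\<close>; the same constant serves for the word bound.\<close>
proof (intro exI[of _ noc_program] exI[of _ 60] allI impI)
  fix G :: "nat graph" and adj
  assume *: "(threshold_graph G \<and> min_degree G \<ge> 1 \<and> \<not> is_star G) \<and> adjacency_lists G adj"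
  define n where "n = length adj"
  have V: "verts G = {..<n}" using * by (simp add: adjacency_lists_def n_def)
  have sg: "simple_graph G" using * by (simp add: threshold_graph_def)
  then have "verts G \<noteq> {}" by (simp add: simple_graph_def)
  then have n1: "1 \<le> n" using V by (cases n) auto
  let ?M = "mem (init_config (encode adj))"
  let ?W = "60 * (card (verts G) + card (edges G))"
  have deg: "length (adj ! v) = degree G v" if "v < n" for v
    using adjacency_lists_degree * that n_def by blast
  have "(\<Sum>j<n. length (adj ! j)) = (\<Sum>v\<in>verts G. degree G v)" using deg V by simp
  then have len: "(\<Sum>j<n. length (adj ! j)) \<le> 2 * card (edges G)" using sum_degree_le[OF sg] by simp
  have W: "n + 2 + (\<Sum>j<n. length (adj ! j)) \<le> ?W" using len n1 V by simp
  have M: "?M i \<le> ?W" for i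
    using encode_bound[OF conjunct2[OF *] sg] W unfolding n_def by (rule le_trans)
  have "?M 0 = n" by (simp add: encode_zero n_def)
  moreover have "n + 2 \<le> ?W" using V n1 by simp
  ultimately have run: "ram_computes noc_program (encode adj)
      (n + 2 ^ (1 + (\<Sum>v<n. 1 div (?M (v + 2) - ?M (v + 1))))) (23 * n + 37) ?W"
    using n1 M by (intro noc_program_correct)
  have "1 div (?M (v + 2) - ?M (v + 1)) = (if degree G v = 1 then 1 else 0)" if "v < n" for v
  proof -
    have "?M (v + 2) - ?M (v + 1) = degree G v"
      using that deg[OF that] encode_address[of "Suc v" adj] encode_address[of v adj]
      by (simp add: n_def)
    \<comment> \<open>The quotient is 0 for degrees above 1, and also for degree 0, by the
      convention for division by zero.\<close>
    then show ?thesis by (auto simp: div_eq_0_iff)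
  qed
  then have "(\<Sum>v<n. 1 div (?M (v + 2) - ?M (v + 1))) = (\<Sum>v<n. if degree G v = 1 then 1 else 0)"
    by (intro sum.cong) auto
  also have "\<dots> = card (leaves G)"
    by (simp add: leaves_def V sum.If_cases Int_def)
  finally have "n + 2 ^ (1 + (\<Sum>v<n. 1 div (?M (v + 2) - ?M (v + 1)))) = noc G"
    using noc_threshold[of G] * V by simp
  then have "ram_computes noc_program (encode adj) (noc G) (23 * n + 37) ?W" using run by simp
  moreover have "23 * n + 37 \<le> ?W" using V n1 by simp
  ultimately show "ram_computes noc_program (encode adj) (noc G) ?W ?W"
    unfolding ram_computes_def by (meson le_trans)
qed

theorem theorem3p3:
  "(\<forall>(G :: 'a graph) K S S1.
      threshold_graph G \<and> min_degree G \<ge> 1 \<and> \<not> is_star G \<and>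
      canonical_split_partition G K S \<and> S1 = {s \<in> S. degree G s = 1} \<longrightarrow>
      noc G = (card S + 1) + card K
                + (if min_degree G \<ge> 2 then 0 else 2 ^ card S1 - 1) + 2 ^ card S1)
   \<and> linear_time_computable
       (\<lambda>G. threshold_graph G \<and> min_degree G \<ge> 1 \<and> \<not> is_star G) noc"
proof (intro conjI allI impI)
  fix G :: "'a graph" and K S S1
  assume "threshold_graph G \<and> min_degree G \<ge> 1 \<and> \<not> is_star G \<and>
    canonical_split_partition G K S \<and> S1 = {s \<in> S. degree G s = 1}"
  then show "noc G = (card S + 1) + card K
      + (if min_degree G \<ge> 2 then 0 else 2 ^ card S1 - 1) + 2 ^ card S1"
    by (elim conjE) (rule noc_canonical)
qed (rule noc_linear_time)

end
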